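(* Let $p$ be a prime, and let $k$ be an integer with $2\le k\le \sqrt{p/(2\log p+1)}-1$. Let $A$ be a multiset contained in $\mathbb{Z}_p^2\setminus\{\mathbf 0\}$ with $|A| = p+k$. If $\#\Sigma A < (k+2)p$, then there exists a nontrivial proper subgroup of $\mathbb{Z}_p^2$ (that is, a subgroup of order $p$) that contains at least $p$ points of $A$, counting multiplicity.
   Context: $\log$ is the natural logarithm. $\mathbb{Z}_p$ is the cyclic group of order $p$, and $\mathbb{Z}_p^2=\mathbb{Z}_p\oplus\mathbb{Z}_p$ with identity $\mathbf 0=(0,0)$. Multisets are finite. For a multiset $S$, $|S|$ is the total number of elements of $S$ counted with multiplicity, and $\#S$ is the number of distinct elements of $S$. If $A$ is a multiset in an abelian group $G$ in which $x$ occurs with multiplicity $m_x$, its sumset is the set $\Sigma A=\{\sum_{x\in G}\delta_x x : 0\le\delta_x\le m_x,\ \delta_x\in\mathbb{Z}\}$ of all sums of submultisets of $A$ (including the empty sum). *)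

theory Defs
  imports Complex_Main "HOL-Algebra.Elementary_Groups" "HOL-Algebra.FiniteProduct" "HOL-Library.Multiset"
    "HOL-Computational_Algebra.Primes"
begin

text \<open>The carrier of \<open>integer_mod_group p\<close> is \<open>{0..<int p}\<close> with addition modulo \<open>p\<close>. The group is
  written multiplicatively in HOL-Algebra; its unit is \<open>(0, 0)\<close>.\<close>

abbreviation Zp2 :: "nat \<Rightarrow> (int \<times> int) monoid"
  where "Zp2 p \<equiv> integer_mod_group p \<times>\<times> integer_mod_group p"

text \<open>The set of all \<open>\<Sum>x. \<delta> x * x\<close> with \<open>\<delta> x \<le> count A x\<close>. The sum runs over the finite support
  of \<open>A\<close> only, as \<open>\<delta>\<close> vanishes elsewhere and \<open>finprod\<close> over an infinite set would be trivial.\<close>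

definition sumset :: "('a, 'b) monoid_scheme \<Rightarrow> 'a multiset \<Rightarrow> 'a set"
  where "sumset G A =
    {finprod G (\<lambda>x. x [^]\<^bsub>G\<^esub> \<delta> x) (set_mset A) | \<delta> :: 'a \<Rightarrow> nat. \<forall>x. \<delta> x \<le> count A x}"

end

theory Submission
  imports Defs "HOL-Algebra.Multiplicative_Group"
begin

text \<open>
  Call the subgroups of order \<open>p\<close> lines, and suppose that every line contains fewer than \<open>p\<close> points
  of \<open>A\<close>. The claim is that \<open>\<Sigma>A\<close> has at least \<open>(k + 2) p\<close> elements. Everything rests on what happens
  when one point \<open>a\<close> is added to a multiset with sumset \<open>S\<close>: the new sumset is \<open>S \<union> (a + S)\<close>, and in
  each coset of the line \<open>\<langle>a\<rangle>\<close> that meets \<open>S\<close> without lying in \<open>S\<close> at least one new element appears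
  (\<open>card_Un_translate\<close>). In a group of prime order this says that a sumset gains an element with each
  nonzero point until it is the whole group (\<open>card_sumset_prime_order\<close>).

  Suppose first that some line \<open>H\<close> contains \<open>m\<close> points with \<open>k < m < p\<close>. The points on \<open>H\<close> give at
  least \<open>m + 1\<close> sums in \<open>H\<close>, and the other \<open>p + k - m\<close> points give sums in at least \<open>p + k - m + 1\<close>
  cosets of \<open>H\<close>. Hence \<open>\<Sigma>A\<close> has at least \<open>(m + 1) (p + k - m + 1)\<close> elements. Subject to
  \<open>k < m < p\<close> this product is smallest at the two ends, where it is \<open>(k + 2) p\<close>
  (\<open>card_sumset_medium_line\<close>).

  Suppose now that every line contains at most \<open>k\<close> points. The points are added one at a time. While
  at least \<open>2 k + 1\<close> of them are unused, there are independent points \<open>a\<close> and \<open>b\<close> among these. Since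
  \<open>\<langle>a\<rangle>\<close> and \<open>\<langle>b\<rangle>\<close> meet only in the identity, an element is determined by its two cosets, so
  \<open>S\<close> meets at least \<open>sqrt (card S)\<close> cosets of one of them. If none of these cosets lies in \<open>S\<close>, adding
  that point gains at least \<open>sqrt (card S)\<close> elements; thus \<open>t\<close> points give about \<open>t\<^sup>2 / 4\<close> sums
  (\<open>quadratic_growth\<close>), which for \<open>t = p - k\<close> is at least \<open>(k + 2) p\<close>. If on the other hand a whole
  coset of a line lies in \<open>S\<close>, then the at least \<open>k + 1\<close> unused points off this line translate it to
  \<open>k + 2\<close> different cosets, and again there are \<open>(k + 2) p\<close> sums (\<open>card_sumset_coset\<close>).
\<close>

section \<open>Sumsets in commutative groups\<close>

text \<open>Factors outside the support are trivial. Enlarging the index set makes the sumsets of two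
  multisets comparable, although their supports differ.\<close>
lemma (in comm_monoid) sumset_superset:
  assumes "finite F" "set_mset M \<subseteq> F" "F \<subseteq> carrier G"
  shows "sumset G M = {finprod G (\<lambda>x. x [^] \<delta> x) F | \<delta> :: 'a \<Rightarrow> nat. \<forall>x. \<delta> x \<le> count M x}"
proof -
  have "finprod G (\<lambda>x. x [^] \<delta> x) (set_mset M) = finprod G (\<lambda>x. x [^] \<delta> x) F"
    if "\<forall>x. \<delta> x \<le> count M x" for \<delta> :: "'a \<Rightarrow> nat"
  proof (rule finprod_mono_neutral_cong_left)
    fix x assume "x \<in> F - set_mset M"
    then have "\<delta> x = 0"
      using that by (metis DiffD2 le_zero_eq not_in_iff)
    then show "x [^] \<delta> x = \<one>" by simp
  qed (use assms in auto)
  then show ?thesis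
    unfolding sumset_def by (intro Collect_cong) metis
qed

lemma (in comm_monoid) sumset_empty [simp]: "sumset G {#} = {\<one>}"
  by (auto simp: sumset_def)

text \<open>A sum uses the additional copy of \<open>a\<close> or does not. All later facts about sumsets go through this
  recursion, by induction on the multiset, instead of the multiplicity functions of the definition.\<close>
lemma (in comm_monoid) sumset_add_mset:
  assumes "a \<in> carrier G" "set_mset M \<subseteq> carrier G"
  shows "sumset G (add_mset a M) = sumset G M \<union> (\<otimes>) a ` sumset G M"
proof -
  define F where "F = set_mset (add_mset a M)"
  have F: "finite F" "F \<subseteq> carrier G" "a \<in> F" using assms by (auto simp: F_def)
  have S: "sumset G M = {finprod G (\<lambda>x. x [^] \<delta> x) F | \<delta> :: 'a \<Rightarrow> nat. \<forall>x. \<delta> x \<le> count M x}"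
    by (rule sumset_superset) (use F in \<open>auto simp: F_def\<close>)
  have T: "sumset G (add_mset a M) =
      {finprod G (\<lambda>x. x [^] \<delta> x) F | \<delta> :: 'a \<Rightarrow> nat. \<forall>x. \<delta> x \<le> count (add_mset a M) x}"
    by (rule sumset_superset) (use F in \<open>auto simp: F_def\<close>)
  have bump: "finprod G (\<lambda>x. x [^] (\<delta>(a := Suc (\<delta> a))) x) F = a \<otimes> finprod G (\<lambda>x. x [^] \<delta> x) F"
    for \<delta> :: "'a \<Rightarrow> nat"
  proof -
    have ins: "finprod G (\<lambda>x. x [^] \<delta> x) F =
      (a [^] \<delta> a) \<otimes> finprod G (\<lambda>x. x [^] \<delta> x) (F - {a})" for \<delta> :: "'a \<Rightarrow> nat"
    proof -
      have "finprod G (\<lambda>x. x [^] \<delta> x) (insert a (F - {a})) =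
          (a [^] \<delta> a) \<otimes> finprod G (\<lambda>x. x [^] \<delta> x) (F - {a})"
        using F by (intro finprod_insert) auto
      then show ?thesis
        using F(3) by (simp add: insert_absorb)
    qed
    have "finprod G (\<lambda>x. x [^] (\<delta>(a := Suc (\<delta> a))) x) (F - {a}) = finprod G (\<lambda>x. x [^] \<delta> x) (F - {a})"
      using F by (intro finprod_cong') auto
    moreover have "finprod G (\<lambda>x. x [^] \<delta> x) (F - {a}) \<in> carrier G"
      using F by (intro finprod_closed) auto
    moreover have "finprod G (\<lambda>x. x [^] (\<delta>(a := Suc (\<delta> a))) x) F =
        (a [^] Suc (\<delta> a)) \<otimes> finprod G (\<lambda>x. x [^] (\<delta>(a := Suc (\<delta> a))) x) (F - {a})"
      using ins[of "\<delta>(a := Suc (\<delta> a))"] by (simp only: fun_upd_same)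
    ultimately show ?thesis
      unfolding ins[of \<delta>] using assms(1) by (simp only: nat_pow_Suc2 m_assoc nat_pow_closed)
  qed
  show ?thesis
  proof (intro equalityI subsetI)
    fix y assume "y \<in> sumset G (add_mset a M)"
    then obtain \<delta> :: "'a \<Rightarrow> nat" where y: "y = finprod G (\<lambda>x. x [^] \<delta> x) F"
      and \<delta>: "\<forall>x. \<delta> x \<le> count (add_mset a M) x" unfolding T by blast
    show "y \<in> sumset G M \<union> (\<otimes>) a ` sumset G M"
    proof (cases "\<delta> a \<le> count M a")
      case True
      then have "\<forall>x. \<delta> x \<le> count M x" using \<delta> by (metis count_add_mset)
      then show ?thesis using y unfolding S by blast
    next
      case False
      \<comment> \<open>All copies of \<open>a\<close> are used, so one of them can be split off.\<close>
      define \<epsilon> where "\<epsilon> = \<delta>(a := count M a)"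
      have "\<delta> a = Suc (count M a)" using False \<delta>[rule_format, of a] by simp
      then have "\<delta> = \<epsilon>(a := Suc (\<epsilon> a))" by (auto simp: \<epsilon>_def)
      then have "y = a \<otimes> finprod G (\<lambda>x. x [^] \<epsilon> x) F" using y bump[of \<epsilon>] by metis
      moreover have "\<forall>x. \<epsilon> x \<le> count M x" using \<delta> by (auto simp: \<epsilon>_def split: if_splits)
      ultimately show ?thesis unfolding S by blast
    qed
  next
    fix y assume "y \<in> sumset G M \<union> (\<otimes>) a ` sumset G M"
    then show "y \<in> sumset G (add_mset a M)"
    proof
      assume "y \<in> sumset G M"
      then show ?thesis unfolding S T by (fastforce intro: le_SucI)
    next
      assume "y \<in> (\<otimes>) a ` sumset G M"
      then obtain \<delta> :: "'a \<Rightarrow> nat" where y: "y = a \<otimes> finprod G (\<lambda>x. x [^] \<delta> x) F"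
        and \<delta>: "\<forall>x. \<delta> x \<le> count M x" unfolding S by blast
      have "\<forall>x. (\<delta>(a := Suc (\<delta> a))) x \<le> count (add_mset a M) x" using \<delta> by simp
      then show ?thesis unfolding T y bump[symmetric] by blast
    qed
  qed
qed

lemma (in comm_monoid) sumset_in_carrier:
  "set_mset M \<subseteq> carrier G \<Longrightarrow> sumset G M \<subseteq> carrier G"
  by (induction M) (auto simp: sumset_add_mset)

lemma (in comm_monoid) finite_sumset:
  "set_mset M \<subseteq> carrier G \<Longrightarrow> finite (sumset G M)"
  by (induction M) (auto simp: sumset_add_mset)

lemma (in comm_monoid) one_in_sumset:
  "set_mset M \<subseteq> carrier G \<Longrightarrow> \<one> \<in> sumset G M"
  by (induction M) (auto simp: sumset_add_mset)

lemma (in comm_group) sumset_union: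
  assumes "set_mset M \<subseteq> carrier G" "set_mset N \<subseteq> carrier G"
  shows "sumset G (M + N) = sumset G M <#> sumset G N"
  using assms(1)
proof (induction M)
  case empty
  show ?case
    using sumset_in_carrier[OF assms(2)] by (force simp: set_mult_def)
next
  case (add a M)
  then have *: "a \<in> carrier G" "sumset G M \<subseteq> carrier G" "sumset G N \<subseteq> carrier G"
    using sumset_in_carrier assms(2) by auto
  have "(\<otimes>) a ` (sumset G M <#> sumset G N) = ((\<otimes>) a ` sumset G M) <#> sumset G N"
    unfolding set_mult_def image_UN UN_extend_simps(10)[symmetric]
    using * by (auto simp: m_assoc subset_iff intro!: SUP_cong)
  then show ?case
    using add assms(2) by (auto simp: sumset_add_mset set_mult_def)
qed

text \<open>The image of \<open>M\<close> keeps its multiplicities even where \<open>h\<close> is not injective; this is what allows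
  counting in a quotient group.\<close>
lemma sumset_hom_image:
  assumes "comm_group G" "comm_group K" "h \<in> hom G K" "set_mset M \<subseteq> carrier G"
  shows "sumset K (image_mset h M) = h ` sumset G M"
proof -
  interpret G: comm_group G by fact
  interpret K: comm_group K by fact
  show ?thesis
    using assms(4)
  proof (induction M)
    case empty
    show ?case using hom_one[OF assms(3) G.group_axioms K.group_axioms] by simp
  next
    case (add a M)
    have sub: "sumset G M \<subseteq> carrier G" using add G.sumset_in_carrier by auto
    have hM: "set_mset (image_mset h M) \<subseteq> carrier K" "h a \<in> carrier K"
      using add assms(3) by (auto simp: hom_def)
    have "(\<lambda>x. h a \<otimes>\<^bsub>K\<^esub> h x) ` sumset G M = (\<lambda>x. h (a \<otimes>\<^bsub>G\<^esub> x)) ` sumset G M"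
      using sub add.prems by (intro image_cong) (auto simp: hom_mult[OF assms(3)] subset_iff)
    then show ?case
      using add hM by (simp add: K.sumset_add_mset G.sumset_add_mset image_Un image_image)
  qed
qed

section \<open>Growth of a set under translation\<close>

text \<open>If \<open>S\<close> meets a coset of \<open>\<langle>a\<rangle>\<close> but does not contain it, then somewhere along the orbit of the
  translation by \<open>a\<close> in this coset there is a step that leaves \<open>S\<close>. Such steps in different cosets
  end at different elements.\<close>

lemma (in comm_group) card_Un_translate:
  assumes fin: "finite (carrier G)" and a: "a \<in> carrier G" and S: "S \<subseteq> carrier G"
    and no: "\<And>x. x \<in> S \<Longrightarrow> \<not> generate G {a} #> x \<subseteq> S"
  shows "card S + card ((#>) (generate G {a}) ` S) \<le> card (S \<union> (\<otimes>) a ` S)"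
proof -
  define H where "H = generate G {a}"
  have H: "subgroup H G" using a by (simp add: H_def generate_is_subgroup)
  have aH: "a \<in> H" by (simp add: H_def generate.incl)
  have same: "H #> (a \<otimes> x) = H #> x" if "x \<in> carrier G" for x
    using that aH H a by (metis rcosI repr_independence subgroup.subset)
  have ex: "\<exists>x\<in>S. H #> x = c \<and> a \<otimes> x \<notin> S" if c: "c \<in> (#>) H ` S" for c
  proof (rule ccontr)
    assume neg: "\<not> ?thesis"
    \<comment> \<open>Then \<open>S\<close> is closed under translation by \<open>a\<close> inside \<open>c\<close>, so it contains the orbit, which is \<open>c\<close>.\<close>
    obtain x where x: "x \<in> S" "c = H #> x" using c by blast
    have xc: "x \<in> carrier G" using x S by blast
    have "a [^] n \<otimes> x \<in> S \<and> H #> (a [^] n \<otimes> x) = c" for n :: nat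
    proof (induction n)
      case 0 then show ?case using x xc by simp
    next
      case (Suc n)
      then have "a \<otimes> (a [^] n \<otimes> x) \<in> S" using neg by blast
      moreover have "H #> (a \<otimes> (a [^] n \<otimes> x)) = c" using Suc same[of "a [^] n \<otimes> x"] S by auto
      moreover have "a \<otimes> (a [^] n \<otimes> x) = a [^] Suc n \<otimes> x"
        using a xc by (simp add: m_ac)
      ultimately show ?case by simp
    qed
    then have "H #> x \<subseteq> S"
      unfolding H_def r_coset_def generate_pow_on_finite_carrier[OF fin a] by auto
    then show False using no x by (simp add: H_def)
  qed
  then obtain f where f: "\<And>c. c \<in> (#>) H ` S \<Longrightarrow> f c \<in> S \<and> H #> f c = c \<and> a \<otimes> f c \<notin> S"
    by metis
  have "card ((#>) H ` S) \<le> card ((\<otimes>) a ` S - S)"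
  proof (rule card_inj_on_le)
    show "inj_on (\<lambda>c. a \<otimes> f c) ((#>) H ` S)"
    proof (rule inj_onI)
      fix c d assume cd: "c \<in> (#>) H ` S" "d \<in> (#>) H ` S" "a \<otimes> f c = a \<otimes> f d"
      then have "f c = f d" using f S a by (metis Units_eq Units_l_cancel subsetD)
      then show "c = d" using f cd by metis
    qed
    show "(\<lambda>c. a \<otimes> f c) ` (#>) H ` S \<subseteq> (\<otimes>) a ` S - S" using f by blast
    show "finite ((\<otimes>) a ` S - S)" using S fin finite_subset by blast
  qed
  moreover have "card (S \<union> (\<otimes>) a ` S) = card S + card ((\<otimes>) a ` S - S)"
  proof -
    have "finite S" using S fin finite_subset by blast
    then show ?thesis
      by (metis Diff_disjoint Un_Diff_cancel card_Un_disjoint finite_Diff finite_imageI)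
  qed
  ultimately show ?thesis by (simp add: H_def)
qed

lemma (in group) subgroup_of_prime_order:
  assumes "Factorial_Ring.prime (order G)" "subgroup H G"
  shows "H = {\<one>} \<or> H = carrier G"
proof -
  have "card H dvd order G" using lagrange[OF assms(2)] by (metis dvd_triv_right)
  then have "card H = 1 \<or> card H = order G" using assms(1) by (metis prime_nat_iff)
  moreover have fin: "finite (carrier G)" using prime_gt_0_nat[OF assms(1)] order_gt_0_iff_finite by simp
  moreover have "\<one> \<in> H" "H \<subseteq> carrier G" using assms(2) by (auto simp: subgroup_def)
  ultimately show ?thesis unfolding order_def by (metis card_1_singletonE card_subset_eq singletonD)
qed

text \<open>Here \<open>\<langle>a\<rangle>\<close> is the whole group for every \<open>a\<close> other than the identity, so its only coset lies in
  \<open>S\<close> exactly when the sumset is already everything.\<close>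
lemma (in comm_group) card_sumset_prime_order:
  assumes prime: "Factorial_Ring.prime (order G)" and M: "set_mset M \<subseteq> carrier G - {\<one>}"
  shows "min (order G) (size M + 1) \<le> card (sumset G M)"
  using M
proof (induction M)
  case empty
  then show ?case by simp
next
  case (add a M)
  define S where "S = sumset G M"
  have fin: "finite (carrier G)" using prime_gt_0_nat[OF prime] order_gt_0_iff_finite by simp
  have a: "a \<in> carrier G" "a \<noteq> \<one>" and S: "S \<subseteq> carrier G" "\<one> \<in> S" and eq: "sumset G (add_mset a M) = S \<union> (\<otimes>) a ` S"
    using add.prems sumset_in_carrier[of M] one_in_sumset[of M] sumset_add_mset[of a M] by (auto simp: S_def)
  have IH: "min (order G) (size M + 1) \<le> card S" using add by (simp add: S_def)
  have gen: "generate G {a} = carrier G"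
    using subgroup_of_prime_order[OF prime generate_is_subgroup[of "{a}"]] a generate.incl[of a "{a}" G] by auto
  show ?case
  proof (cases "S = carrier G")
    case True
    then have "sumset G (add_mset a M) = carrier G" using eq a by auto
    then show ?thesis by (simp add: order_def)
  next
    case False
    have "card S + card ((#>) (generate G {a}) ` S) \<le> card (S \<union> (\<otimes>) a ` S)"
    proof (rule card_Un_translate[OF fin a(1) S(1)])
      fix x assume "x \<in> S"
      then have "generate G {a} #> x = carrier G"
        unfolding gen using S by (metis coset_join2 subgroup_self subsetD)
      then show "\<not> generate G {a} #> x \<subseteq> S" using False S by blast
    qed
    moreover have "card ((#>) (generate G {a}) ` S) \<noteq> 0"
      using S fin finite_subset by (metis card_eq_0_iff empty_iff finite_imageI image_is_empty)
    ultimately show ?thesis using IH eq by simp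
  qed
qed

text \<open>Pick one representative in \<open>U\<close> for every coset of \<open>H\<close> that \<open>U\<close> meets. The translates of \<open>T\<close> by
  these representatives lie in different cosets of \<open>H\<close>, hence are disjoint.\<close>
lemma (in comm_group) card_coset_mult:
  assumes fin: "finite (carrier G)" and H: "subgroup H G" and g: "g \<in> carrier G"
    and T: "T \<subseteq> H #> g" and U: "U \<subseteq> carrier G"
  shows "card T * card ((#>) H ` U) \<le> card (T <#> U)"
proof -
  have "\<forall>c\<in>(#>) H ` U. \<exists>u\<in>U. H #> u = c" by blast
  then obtain f where f: "\<And>c. c \<in> (#>) H ` U \<Longrightarrow> f c \<in> U \<and> H #> f c = c" by metis
  have Tc: "T \<subseteq> carrier G" using T H g r_coset_subset_G subgroup.subset by blast
  have "card (T \<times> (#>) H ` U) \<le> card (T <#> U)"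
  proof (rule card_inj_on_le)
    show "(\<lambda>(t, c). t \<otimes> f c) ` (T \<times> (#>) H ` U) \<subseteq> T <#> U"
      using f by (auto simp: set_mult_def)
    show "finite (T <#> U)"
      using Tc U fin by (meson finite_subset set_mult_closed)
    show "inj_on (\<lambda>(t, c). t \<otimes> f c) (T \<times> (#>) H ` U)"
    proof (rule inj_onI, clarify)
      \<comment> \<open>The coset of \<open>u\<close> can be read off from the product \<open>t \<otimes> u\<close>, as \<open>t \<in> H #> g\<close>.\<close>
      have key: "H #> (inv g \<otimes> (t \<otimes> u)) = H #> u" if tu: "t \<in> T" "u \<in> U" for t u
      proof -
        obtain h where h: "h \<in> H" "t = h \<otimes> g" using tu T by (auto simp: r_coset_def)
        have "h \<in> carrier G" "u \<in> carrier G" using h H tu U subgroup.subset by blast+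
        then have "inv g \<otimes> (t \<otimes> u) = h \<otimes> u"
          using h g by (metis inv_closed l_one m_assoc m_comm m_closed r_inv)
        then show ?thesis
          using \<open>u \<in> carrier G\<close> h H by (metis rcosI repr_independence subgroup.subset)
      qed
      fix t u t' u'
      assume *: "t \<in> T" "u \<in> U" "t' \<in> T" "u' \<in> U" "t \<otimes> f (H #> u) = t' \<otimes> f (H #> u')"
      have fu: "f (H #> u) \<in> U" "H #> f (H #> u) = H #> u" "f (H #> u') \<in> U" "H #> f (H #> u') = H #> u'"
        using f * by blast+
      then have "H #> u = H #> u'" using key * by metis
      then show "t = t' \<and> H #> u = H #> u'" using * fu Tc U by (metis right_cancel subsetD)
    qed
  qed
  then show ?thesis by (simp add: card_cartesian_product)
qed

lemma (in comm_group) sumset_mono: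
  assumes "M \<subseteq># N" "set_mset N \<subseteq> carrier G"
  shows "sumset G M \<subseteq> sumset G N"
proof -
  have sub: "set_mset M \<subseteq> carrier G" "set_mset (N - M) \<subseteq> carrier G"
    using assms by (auto dest: mset_subset_eqD in_diffD)
  have "sumset G N = sumset G M <#> sumset G (N - M)"
    using sumset_union[OF sub] assms(1) by simp
  moreover have "x \<in> sumset G M <#> sumset G (N - M)" if "x \<in> sumset G M" for x
  proof -
    have "x \<otimes> \<one> = x" using that sub sumset_in_carrier by (intro r_one) blast
    then show ?thesis
      using that one_in_sumset[OF sub(2)] unfolding set_mult_def by force
  qed
  ultimately show ?thesis by blast
qed

lemma (in comm_group) comm_group_subgroup:
  assumes "subgroup H G"
  shows "comm_group (G\<lparr>carrier := H\<rparr>)"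
  using assms subgroup.subset[OF assms]
  by (intro group.group_comm_groupI[OF subgroup_imp_group]) (auto intro: m_comm)

lemma (in comm_group) sumset_subgroup:
  assumes H: "subgroup H G" and M: "set_mset M \<subseteq> H"
  shows "sumset (G\<lparr>carrier := H\<rparr>) M = sumset G M"
proof -
  have "comm_group (G\<lparr>carrier := H\<rparr>)" using H by (rule comm_group_subgroup)
  moreover have "id \<in> hom (G\<lparr>carrier := H\<rparr>) G" using H by (auto simp: hom_def subgroup_def)
  ultimately have "sumset G (image_mset id M) = id ` sumset (G\<lparr>carrier := H\<rparr>) M"
    using M by (intro sumset_hom_image) (auto simp: comm_group_axioms)
  then show ?thesis by simp
qed

lemma (in comm_group) sumset_in_subgroup:
  assumes "subgroup H G" "set_mset M \<subseteq> H"
  shows "sumset G M \<subseteq> H"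
proof -
  interpret H: comm_group "G\<lparr>carrier := H\<rparr>" using assms(1) by (rule comm_group_subgroup)
  show ?thesis using H.sumset_in_carrier[of M] assms sumset_subgroup by simp
qed

lemma (in comm_group) card_sumset_subgroup:
  assumes H: "subgroup H G" and prime: "Factorial_Ring.prime (card H)" and M: "set_mset M \<subseteq> H - {\<one>}"
  shows "min (card H) (size M + 1) \<le> card (sumset G M)"
proof -
  interpret H: comm_group "G\<lparr>carrier := H\<rparr>" using H by (rule comm_group_subgroup)
  have "sumset (G\<lparr>carrier := H\<rparr>) M = sumset G M" using H M by (intro sumset_subgroup) auto
  then show ?thesis using H.card_sumset_prime_order[of M] prime M by (simp add: order_def)
qed

lemma (in comm_group) card_cosets_sumset:
  assumes H: "subgroup H G" and prime: "Factorial_Ring.prime (card (rcosets H))"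
    and M: "set_mset M \<subseteq> carrier G - H"
  shows "min (card (rcosets H)) (size M + 1) \<le> card ((#>) H ` sumset G M)"
proof -
  have Q: "comm_group (G Mod H)" using H by (rule abelian_FactGroup)
  interpret Q: comm_group "G Mod H" by (rule Q)
  have ord: "order (G Mod H) = card (rcosets H)" by (simp add: order_def FactGroup_def)
  have hom: "(#>) H \<in> hom G (G Mod H)"
    using normal.r_coset_hom_Mod[OF subgroup_imp_normal[OF H]] .
  have img: "sumset (G Mod H) (image_mset ((#>) H) M) = (#>) H ` sumset G M"
    using M by (intro sumset_hom_image[OF comm_group_axioms Q hom]) auto
  have "set_mset (image_mset ((#>) H) M) \<subseteq> carrier (G Mod H) - {\<one>\<^bsub>G Mod H\<^esub>}"
  proof
    fix c assume "c \<in> set_mset (image_mset ((#>) H) M)"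
    then obtain x where x: "x \<in> carrier G" "x \<notin> H" "c = H #> x" using M by auto
    have "c \<noteq> H" using x H by (metis rcos_self)
    then show "c \<in> carrier (G Mod H) - {\<one>\<^bsub>G Mod H\<^esub>}"
      using x H subgroup.subset by (auto simp: FactGroup_def intro!: rcosetsI)
  qed
  then show ?thesis
    using Q.card_sumset_prime_order[of "image_mset ((#>) H) M"] prime ord img by simp
qed

text \<open>For naturals, \<open>(t + 2)\<^sup>2 \<le> 4 s + 1\<close> says that \<open>s\<close> is at least the quarter square
  \<open>\<lfloor>(t + 2)\<^sup>2 / 4\<rfloor>\<close>, that is, \<open>(u + 1)\<^sup>2\<close> for \<open>t = 2 u\<close> and \<open>(u + 1) (u + 2)\<close> for \<open>t = 2 u + 1\<close>. An
  increment of at least the square root of \<open>s\<close> leads from each quarter square to the next.\<close>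
lemma quarter_square_step:
  fixes s t N :: nat
  assumes "(t + 2)\<^sup>2 \<le> 4 * s + 1" "s \<le> N\<^sup>2"
  shows "(t + 3)\<^sup>2 \<le> 4 * (s + N) + 1"
proof (cases "even t")
  case True
  then obtain u where t: "t = 2 * u" by blast
  have "(t + 2)\<^sup>2 = 4 * (u + 1)\<^sup>2" by (simp add: t power2_eq_square algebra_simps)
  then have s: "(u + 1)\<^sup>2 \<le> s" using assms(1) by linarith
  then have "u + 1 \<le> N" using assms(2) by (meson le_trans power2_nat_le_eq_le)
  moreover have "(t + 3)\<^sup>2 = 4 * (u + 1)\<^sup>2 + 4 * (u + 1) + 1"
    by (simp add: t power2_eq_square algebra_simps)
  ultimately show ?thesis using s by simp
next
  case False
  then obtain u where t: "t = 2 * u + 1" by (elim oddE)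
  have "(t + 2)\<^sup>2 = 4 * ((u + 1) * (u + 2)) + 1" by (simp add: t power2_eq_square algebra_simps)
  then have s: "(u + 1) * (u + 2) \<le> s" using assms(1) by linarith
  have "(u + 1)\<^sup>2 < N\<^sup>2" using s assms(2) by (simp add: power2_eq_square)
  then have "u + 2 \<le> N" using power2_less_imp_less by fastforce
  moreover have "(t + 3)\<^sup>2 = 4 * ((u + 1) * (u + 2)) + 4 * (u + 2)"
    by (simp add: t power2_eq_square algebra_simps)
  ultimately show ?thesis using s by simp
qed

section \<open>Lines in a group of order \<open>p\<^sup>2\<close> and exponent \<open>p\<close>\<close>

text \<open>These are the groups isomorphic to \<open>Zp2 p\<close>. The argument is carried out without coordinates; a line
  is a subgroup \<open>generate G {a}\<close> with \<open>a\<close> different from the identity.\<close>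
locale elementary_abelian_plane = comm_group +
  fixes p :: nat
  assumes prime_p: "Factorial_Ring.prime p"
    and order_eq: "order G = p ^ 2"
    and exponent: "\<And>x. x \<in> carrier G \<Longrightarrow> x [^] p = \<one>"
begin

lemma finite_carrier: "finite (carrier G)"
  using order_gt_0_iff_finite order_eq prime_gt_0_nat[OF prime_p] by simp

lemma subgroup_line: "a \<in> carrier G \<Longrightarrow> subgroup (generate G {a}) G"
  by (simp add: generate_is_subgroup)

lemma card_line:
  assumes "a \<in> carrier G - {\<one>}"
  shows "card (generate G {a}) = p"
proof -
  have "ord a dvd p" using assms exponent pow_eq_id by simp
  moreover have "ord a \<noteq> 1" using assms ord_eq_1 by simp
  ultimately show ?thesis
    using prime_p generate_pow_card assms by (metis DiffD1 prime_nat_iff)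
qed

lemma card_rcosets_line:
  assumes "a \<in> carrier G - {\<one>}"
  shows "card (rcosets (generate G {a})) = p"
proof -
  have "card (rcosets (generate G {a})) * p = p * p"
    using lagrange[OF subgroup_line[of a]] assms card_line[OF assms] order_eq by (simp add: power2_eq_square)
  then show ?thesis using prime_gt_0_nat[OF prime_p] by simp
qed

text \<open>Two lines with independent directions meet only in the identity, so they serve as coordinate axes:
  an element is determined by its coset of \<open>\<langle>a\<rangle>\<close> together with its coset of \<open>\<langle>b\<rangle>\<close>.\<close>
lemma card_le_mult_cosets:
  assumes a: "a \<in> carrier G" and b: "b \<in> carrier G - generate G {a}" and S: "S \<subseteq> carrier G"
  shows "card S \<le> card ((#>) (generate G {a}) ` S) * card ((#>) (generate G {b}) ` S)"
proof -
  define H K where "H = generate G {a}" and "K = generate G {b}"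
  have H: "subgroup H G" and K: "subgroup K G" using a b subgroup_line by (auto simp: H_def K_def)
  have bK: "b \<in> K" by (simp add: K_def generate.incl)
  have "b \<noteq> \<one>" using b H unfolding H_def[symmetric] by (auto simp: subgroup_def)
  then have cK: "card K = p" using b card_line by (simp add: K_def)
  interpret K: comm_group "G\<lparr>carrier := K\<rparr>" using K by (rule comm_group_subgroup)
  have "subgroup (H \<inter> K) (G\<lparr>carrier := K\<rparr>)"
    using H K by (intro subgroup_incl subgroups_Inter_pair) auto
  then have "H \<inter> K = {\<one>} \<or> H \<inter> K = K"
    using K.subgroup_of_prime_order[of "H \<inter> K"] cK prime_p by (simp add: order_def)
  then have HK: "H \<inter> K = {\<one>}" using bK b by (auto simp: H_def)
  have quot: "x \<otimes> inv y \<in> L" if "L #> x = L #> y" "subgroup L G" "x \<in> carrier G" "y \<in> carrier G" for L x y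
  proof -
    have "x \<in> L #> y" using that rcos_self by metis
    then obtain h where "h \<in> L" "x = h \<otimes> y" by (auto simp: r_coset_def)
    moreover have "h \<in> carrier G" using \<open>h \<in> L\<close> that subgroup.subset by blast
    ultimately show ?thesis using that by (simp add: m_assoc)
  qed
  have "card S \<le> card ((#>) H ` S \<times> (#>) K ` S)"
  proof (rule card_inj_on_le)
    show "inj_on (\<lambda>x. (H #> x, K #> x)) S"
    proof (rule inj_onI)
      fix x y assume xy: "x \<in> S" "y \<in> S" "(H #> x, K #> x) = (H #> y, K #> y)"
      then have "x \<otimes> inv y \<in> H \<inter> K" using quot H K S by blast
      then have "x \<otimes> inv y = \<one>" using HK by blast
      then show "x = y" using xy S by (metis inv_equality inv_inv inv_closed subsetD)
    qed
    show "finite ((#>) H ` S \<times> (#>) K ` S)" using S finite_carrier finite_subset by blast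
  qed auto
  then show ?thesis by (simp add: card_cartesian_product H_def K_def)
qed

text \<open>Sums inside one coset of a line are multiplied by points off the line: their sums reach a new
  coset with each point, and every coset reached receives its own translate of \<open>T\<close>. This is used with
  \<open>T\<close> inside the line itself and with \<open>T\<close> a full coset.\<close>
lemma card_sumset_coset:
  assumes a: "a \<in> carrier G - {\<one>}" and g: "g \<in> carrier G"
    and T: "T \<subseteq> generate G {a} #> g" "T \<subseteq> sumset G M"
    and M: "set_mset M \<subseteq> carrier G" and N: "set_mset N \<subseteq> carrier G - generate G {a}"
  shows "card T * min p (size N + 1) \<le> card (sumset G (M + N))"
proof -
  define H where "H = generate G {a}"
  have H: "subgroup H G" using a subgroup_line by (simp add: H_def)
  have Nc: "set_mset N \<subseteq> carrier G" using N by blast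
  have cos: "min p (size N + 1) \<le> card ((#>) H ` sumset G N)"
    using card_cosets_sumset[OF H, of N] card_rcosets_line[OF a] prime_p N by (simp add: H_def)
  have "card T * card ((#>) H ` sumset G N) \<le> card (T <#> sumset G N)"
    using T g H by (intro card_coset_mult finite_carrier sumset_in_carrier Nc) (auto simp: H_def)
  also have "\<dots> \<le> card (sumset G (M + N))"
  proof (rule card_mono)
    show "finite (sumset G (M + N))" using M Nc by (intro finite_sumset) auto
    show "T <#> sumset G N \<subseteq> sumset G (M + N)"
      unfolding sumset_union[OF M Nc] using T by (auto simp: set_mult_def)
  qed
  finally show ?thesis using cos by (meson le_trans mult_le_mono2)
qed

lemma card_coset_line:
  assumes "a \<in> carrier G - {\<one>}" "g \<in> carrier G"
  shows "card (generate G {a} #> g) = p"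
  using assms card_line card_rcosets_equal[OF rcosetsI] subgroup_line subgroup.subset
  by (metis DiffD1)

section \<open>Multisets with few points on every line\<close>

text \<open>Splitting \<open>A\<close> into the points on the line and the points off it gives \<open>(m + 1) (p + k - m + 1)\<close>
  sums, where \<open>m\<close> is the number of points on the line. With \<open>m = k + 1 + u\<close> and \<open>p = m + 1 + v\<close>
  this exceeds \<open>(k + 2) p\<close> by \<open>u v\<close>.\<close>

lemma card_sumset_medium_line:
  assumes A: "set_mset A \<subseteq> carrier G - {\<one>}" "size A = p + k"
    and a: "a \<in> carrier G - {\<one>}"
    and m: "k < size {#x \<in># A. x \<in> generate G {a}#}" "size {#x \<in># A. x \<in> generate G {a}#} < p"
  shows "(k + 2) * p \<le> card (sumset G A)"
proof -
  define H where "H = generate G {a}"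
  define B C where "B = {#x \<in># A. x \<in> H#}" and "C = {#x \<in># A. x \<notin> H#}"
  have ABC: "A = B + C" unfolding B_def C_def by (rule multiset_partition)
  have H: "subgroup H G" and cH: "card H = p" using a subgroup_line card_line by (auto simp: H_def)
  have B: "set_mset B \<subseteq> H - {\<one>}" and C: "set_mset C \<subseteq> carrier G - H"
    using A by (auto simp: B_def C_def)
  have Bc: "set_mset B \<subseteq> carrier G" using B subgroup.subset[OF H] by blast
  have sB: "k < size B" "size B < p" using m by (auto simp: B_def H_def)
  have sC: "size B + size C = p + k" using A(2) ABC by (metis size_union)
  have "sumset G B \<subseteq> H #> \<one>"
    using sumset_in_subgroup[OF H] B coset_mult_one subgroup.subset[OF H] by auto
  then have "card (sumset G B) * min p (size C + 1) \<le> card (sumset G A)"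
    unfolding ABC using card_sumset_coset[OF a one_closed _ _ Bc, of "sumset G B" C] C
    by (simp add: H_def)
  moreover have "size B + 1 \<le> card (sumset G B)"
    using card_sumset_subgroup[OF H _ B] cH prime_p sB by simp
  moreover have "min p (size C + 1) = size C + 1" using sB sC by simp
  ultimately have "(size B + 1) * (size C + 1) \<le> card (sumset G A)"
    by (metis le_trans mult_le_mono1)
  moreover have "(k + 2) * p \<le> (size B + 1) * (size C + 1)"
  proof -
    obtain u where u: "size B = k + 1 + u" using sB(1) less_iff_Suc_add by auto
    obtain v where v: "p = size B + 1 + v" using sB(2) less_iff_Suc_add by auto
    have "size C = k + 1 + v" using u v sC by simp
    then show ?thesis using u v by (simp add: algebra_simps)
  qed
  ultimately show ?thesis by simp
qed

text \<open>Each step adds one of two independent unused points, the one whose line has more cosets meeting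
  the current sumset. The bound \<open>t \<le> p - k\<close> guarantees that at least \<open>2 k + 1\<close> points are unused before
  each step. At most \<open>k\<close> of them lie on any given line, so \<open>k + 1\<close> remain off it, enough both to find
  the second direction and to refute that the sumset contains a coset of the line.\<close>
lemma quadratic_growth:
  assumes A: "set_mset A \<subseteq> carrier G - {\<one>}" "size A = p + k" and k: "k + 2 \<le> p"
    and lines: "\<And>a. a \<in> carrier G - {\<one>} \<Longrightarrow> size {#x \<in># A. x \<in> generate G {a}#} \<le> k"
    and small: "card (sumset G A) < (k + 2) * p"
  shows "t \<le> p - k \<Longrightarrow> \<exists>U. U \<subseteq># A \<and> size U = t \<and> (t + 2)\<^sup>2 \<le> 4 * card (sumset G U) + 1"
proof (induction t)
  case 0
  show ?case by (intro exI[of _ "{#}"]) (simp add: power2_eq_square)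
next
  case (Suc t)
  then obtain U where U: "U \<subseteq># A" "size U = t" "(t + 2)\<^sup>2 \<le> 4 * card (sumset G U) + 1" by auto
  define R S where "R = A - U" and "S = sumset G U"
  have Uc: "set_mset U \<subseteq> carrier G" using U(1) A(1) mset_subset_eqD by fastforce
  have Rc: "set_mset R \<subseteq> carrier G - {\<one>}" using A(1) by (auto simp: R_def dest: in_diffD)
  have Sc: "S \<subseteq> carrier G" using sumset_in_carrier Uc by (simp add: S_def)
  have AU: "A = U + R" using U(1) by (simp add: R_def)
  have "size A = size U + size R" by (subst AU) simp
  then have sR: "2 * k + 1 \<le> size R"
    using A(2) U(2) Suc.prems by linarith
  have off: "k + 1 \<le> size {#x \<in># R. x \<notin> generate G {c}#}" if "c \<in> carrier G - {\<one>}" for c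
  proof -
    have "size {#x \<in># R. x \<in> generate G {c}#} \<le> size {#x \<in># A. x \<in> generate G {c}#}"
      by (intro size_mset_mono multiset_filter_mono) (simp add: R_def)
    moreover have "size R = size {#x \<in># R. x \<in> generate G {c}#} + size {#x \<in># R. x \<notin> generate G {c}#}"
      using multiset_partition size_union by metis
    ultimately show ?thesis using lines[OF that] sR by linarith
  qed
  have grow: "card S + card ((#>) (generate G {c}) ` S) \<le> card (sumset G (add_mset c U))"
    if c: "c \<in> carrier G - {\<one>}" for c
  proof -
    define N where "N = {#x \<in># R. x \<notin> generate G {c}#}"
    have "\<not> generate G {c} #> x \<subseteq> S" if x: "x \<in> S" for x
    proof
      assume full: "generate G {c} #> x \<subseteq> S"
      have xc: "x \<in> carrier G" using x Sc by blast
      have Nc: "set_mset N \<subseteq> carrier G - generate G {c}" using Rc by (auto simp: N_def)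
      have "card (generate G {c} #> x) * min p (size N + 1) \<le> card (sumset G (U + N))"
        using full Nc Uc by (intro card_sumset_coset[OF c xc]) (auto simp: S_def)
      also have "\<dots> \<le> card (sumset G A)"
        using A(1) AU by (intro card_mono finite_sumset sumset_mono) (auto simp: N_def)
      finally have "p * min p (size N + 1) \<le> card (sumset G A)"
        using card_coset_line[OF c xc] by simp
      moreover have "k + 2 \<le> min p (size N + 1)" using k off[OF c] by (simp add: N_def)
      then have "p * (k + 2) \<le> p * min p (size N + 1)" by (rule mult_le_mono2)
      ultimately show False using small by (simp add: mult.commute)
    qed
    then have "card S + card ((#>) (generate G {c}) ` S) \<le> card (S \<union> (\<otimes>) c ` S)"
      using c Sc by (intro card_Un_translate finite_carrier) auto
    then show ?thesis using c Uc by (simp add: S_def sumset_add_mset)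
  qed
  obtain a where a: "a \<in># R" using sR by fastforce
  then have ac: "a \<in> carrier G - {\<one>}" using Rc by blast
  obtain b where b: "b \<in># R" "b \<notin> generate G {a}"
  proof (rule ccontr)
    assume "\<not> thesis"
    then have "set_mset {#x \<in># R. x \<notin> generate G {a}#} = {}" using that by auto
    then have "{#x \<in># R. x \<notin> generate G {a}#} = {#}" by (simp only: set_mset_eq_empty_iff)
    then have "size {#x \<in># R. x \<notin> generate G {a}#} = 0" by (simp only: size_empty)
    then show False using off[OF ac] by linarith
  qed
  then have bc: "b \<in> carrier G - {\<one>}" using Rc by blast
  define n where "n c = card ((#>) (generate G {c}) ` S)" for c
  have "card S \<le> n a * n b"
    using ac bc b Sc unfolding n_def by (intro card_le_mult_cosets) auto
  then obtain c where c: "c = a \<or> c = b" and sq: "card S \<le> (n c)\<^sup>2"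
  proof (cases "n a \<le> n b")
    case True
    then have "n a * n b \<le> (n b)\<^sup>2" by (simp add: power2_eq_square)
    then show ?thesis using that \<open>card S \<le> n a * n b\<close> le_trans by blast
  next
    case False
    then have "n a * n b \<le> (n a)\<^sup>2" by (simp add: power2_eq_square)
    then show ?thesis using that \<open>card S \<le> n a * n b\<close> le_trans by blast
  qed
  have cR: "c \<in># R" "c \<in> carrier G - {\<one>}" using c a b ac bc by auto
  have "(t + 3)\<^sup>2 \<le> 4 * (card S + n c) + 1"
    using U(3) sq by (intro quarter_square_step) (auto simp: S_def)
  then have "(Suc t + 2)\<^sup>2 \<le> 4 * card (sumset G (add_mset c U)) + 1"
    using grow[OF cR(2)] by (simp add: n_def eval_nat_numeral)
  moreover have "add_mset c U \<subseteq># A"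
    using AU cR(1) by (metis add_mset_add_single mset_subset_eq_mono_add_left_cancel mset_subset_eq_single)
  ultimately show ?case using U(2) by (intro exI[of _ "add_mset c U"]) simp
qed

text \<open>Linear size of \<open>p\<close> in \<open>k\<close> makes the quarter square of \<open>p - k + 2\<close> at least \<open>(k + 2) p\<close>, which
  excludes that every line has at most \<open>k\<close> points.\<close>
theorem line_of_small_sumset:
  assumes A: "set_mset A \<subseteq> carrier G - {\<one>}" "size A = p + k" and k: "9 * (k + 1) \<le> p"
    and small: "card (sumset G A) < (k + 2) * p"
  obtains a where "a \<in> carrier G - {\<one>}" "p \<le> size {#x \<in># A. x \<in> generate G {a}#}"
proof (rule ccontr)
  assume no_thesis: "\<not> thesis"
  note line = that
  have less: "size {#x \<in># A. x \<in> generate G {a}#} < p" if a: "a \<in> carrier G - {\<one>}" for a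
  proof (rule ccontr)
    assume "\<not> size {#x \<in># A. x \<in> generate G {a}#} < p"
    then have "p \<le> size {#x \<in># A. x \<in> generate G {a}#}" by (simp only: not_less)
    then show False using line[OF a] no_thesis by blast
  qed
  have "size {#x \<in># A. x \<in> generate G {a}#} \<le> k" if "a \<in> carrier G - {\<one>}" for a
    using card_sumset_medium_line[OF A that] less[OF that] small by (meson not_le)
  then obtain U where U: "U \<subseteq># A" "(p - k + 2)\<^sup>2 \<le> 4 * card (sumset G U) + 1"
    using quadratic_growth[OF A _ _ small, of "p - k"] k by auto
  have "card (sumset G U) \<le> card (sumset G A)"
    using A(1) U(1) by (intro card_mono finite_sumset sumset_mono) auto
  then have "(p - k + 2)\<^sup>2 < 4 * ((k + 2) * p) + 1" using U(2) small by linarith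
  moreover have "4 * ((k + 2) * p) + 1 \<le> (p - k + 2)\<^sup>2"
  proof -
    obtain r where "p = 9 * (k + 1) + r" using k le_Suc_ex by blast
    then show ?thesis by (simp add: power2_eq_square algebra_simps)
  qed
  ultimately show False by simp
qed

end

section \<open>The group \<open>Zp2 p\<close>\<close>


lemma elementary_abelian_plane_Zp2:
  assumes "Factorial_Ring.prime p"
  shows "elementary_abelian_plane (Zp2 p) p"
proof -
  let ?Z = "integer_mod_group p"
  have p: "p > 0" using assms prime_gt_0_nat by simp
  have grp: "group (Zp2 p)" by (intro DirProd_group) auto
  have comm: "comm_group (Zp2 p)"
    by (rule group.group_comm_groupI[OF grp]) (auto simp: add.commute)
  interpret comm_group "Zp2 p" by (rule comm)
  have pow: "x [^]\<^bsub>Zp2 p\<^esub> n = (fst x [^]\<^bsub>?Z\<^esub> n, snd x [^]\<^bsub>?Z\<^esub> n)"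
    for x and n :: nat by (cases x, induction n) auto
  have "order (Zp2 p) = p ^ 2"
    using p by (simp add: order_def DirProd_def carrier_integer_mod_group card_cartesian_product power2_eq_square)
  moreover have "x [^]\<^bsub>Zp2 p\<^esub> p = \<one>\<^bsub>Zp2 p\<^esub>" for x
    by (simp add: pow)
  ultimately show ?thesis
    using assms by unfold_locales auto
qed

text \<open>Squaring gives \<open>(k + 1)\<^sup>2 (2 ln p + 1) \<le> p\<close>. As \<open>k + 1 \<ge> 3\<close>, this first yields \<open>p \<ge> 9 > e\<close>, so
  that the logarithmic factor is at least \<open>3\<close>; the other factor \<open>3\<close> comes from \<open>(k + 1)\<^sup>2 \<ge> 3 (k + 1)\<close>.\<close>
lemma linear_bound_of_sqrt_log_bound:
  fixes p k :: nat
  assumes p: "p > 0" and k: "2 \<le> k" and le: "real k \<le> sqrt (real p / (2 * ln (real p) + 1)) - 1"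
  shows "9 * (k + 1) \<le> p"
proof -
  define L where "L = 2 * ln (real p) + 1"
  have L: "1 \<le> L" using p by (simp add: L_def)
  have "real k + 1 \<le> sqrt (real p / L)" using le by (simp add: L_def)
  then have "(real k + 1)\<^sup>2 \<le> real p / L"
    using L power_mono[of "real k + 1" "sqrt (real p / L)" 2] by simp
  then have main: "(real k + 1)\<^sup>2 * L \<le> real p" using L by (simp add: field_simps)
  have "3\<^sup>2 \<le> (real k + 1)\<^sup>2" using k by (intro power_mono) auto
  then have "9 * 1 \<le> (real k + 1)\<^sup>2 * L" using L by (intro mult_mono) auto
  then have "exp 1 \<le> real p" using main exp_le by linarith
  then have "1 \<le> ln (real p)" using p by (simp add: ln_ge_iff)
  then have "3 \<le> L" by (simp add: L_def)
  then have "(real k + 1)\<^sup>2 * 3 \<le> (real k + 1)\<^sup>2 * L" by (intro mult_left_mono) auto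
  moreover have "3 * (real k + 1) \<le> (real k + 1)\<^sup>2"
    using k mult_right_mono[of 3 "real k + 1" "real k + 1"] by (simp add: power2_eq_square)
  ultimately have "9 * (real k + 1) \<le> real p" using main by linarith
  then have "real (9 * (k + 1)) \<le> real p" by simp
  then show ?thesis by (simp only: of_nat_le_iff)
qed

theorem corollary1p9:
  fixes p k :: nat and A :: "(int \<times> int) multiset"
  assumes "Factorial_Ring.prime p"
    and "2 \<le> k"
    and "real k \<le> sqrt (real p / (2 * ln (real p) + 1)) - 1"
    and "set_mset A \<subseteq> carrier (Zp2 p) - {\<one>\<^bsub>Zp2 p\<^esub>}"
    and "size A = p + k"
    and "card (sumset (Zp2 p) A) < (k + 2) * p"
  shows "\<exists>H. subgroup H (Zp2 p) \<and> H \<noteq> {\<one>\<^bsub>Zp2 p\<^esub>} \<and> H \<noteq> carrier (Zp2 p) \<and> card H = p \<and>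
    p \<le> size (filter_mset (\<lambda>x. x \<in> H) A)"
proof -
  interpret elementary_abelian_plane "Zp2 p" p
    using assms(1) by (rule elementary_abelian_plane_Zp2)
  have p: "1 < p" using assms(1) prime_gt_1_nat by simp
  have "9 * (k + 1) \<le> p"
    using p assms(2,3) by (intro linear_bound_of_sqrt_log_bound) auto
  then obtain a where a: "a \<in> carrier (Zp2 p) - {\<one>\<^bsub>Zp2 p\<^esub>}"
      and many: "p \<le> size {#x \<in># A. x \<in> generate (Zp2 p) {a}#}"
    using line_of_small_sumset[OF assms(4,5) _ assms(6)] by metis
  have card: "card (generate (Zp2 p) {a}) = p" using a by (rule card_line)
  have "card (carrier (Zp2 p)) \<noteq> p"
    using order_eq p by (simp add: order_def power2_eq_square)
  then have "generate (Zp2 p) {a} \<noteq> carrier (Zp2 p)" using card by metis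
  moreover have "generate (Zp2 p) {a} \<noteq> {\<one>\<^bsub>Zp2 p\<^esub>}" using card p by (metis card_1_singleton_iff less_irrefl One_nat_def)
  moreover have "subgroup (generate (Zp2 p) {a}) (Zp2 p)" using a by (intro subgroup_line) blast
  ultimately show ?thesis using many card by blast
qed

end
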